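(* Let $G=(V,E)$ be a strongly connected bidirected graph, let $\mathcal{T}$ be a separator decomposition of $G$, let $\pi$ be a nested dissection order induced by $\mathcal{T}$ with $\mathrm{Rank}(v)=\pi^{-1}(v)$, and let $H$ be the graph obtained by contracting the vertices of $G$ in the order $\pi$. Let $X$ be a node of $\mathcal{T}$, let $G_X$ be the subgraph of $G$ induced by the vertices contained in the subtree $\mathcal{T}_X$, and let $B(X)=\{w\in V\setminus V(G_X) : (v,w)\in E \text{ for some } v\in V(G_X)\}$. Suppose $B(X)\neq\emptyset$ and let $l$ be the lowest-ranked vertex in $B(X)$. Then $S(l)=\bigcup_{b\in B(X)} S(b)$.
   Context: A graph $G=(V,E)$ is bidirected if $(v,w)\in E$ implies $(w,v)\in E$. A separator decomposition of a strongly connected $n$-vertex bidirected graph $G=(V,E)$ is a rooted tree $\mathcal{T}=(\mathcal{X},\mathcal{E})$ whose nodes $X\in\mathcal{X}$ are pairwise disjoint subsets of $V$, defined recursively: if $n=1$, $\mathcal{T}$ is a single node $X=V$; if $n>1$, $\mathcal{T}$ has a root $X\subseteq V$ such that removing $X$ separates $G$ into strongly connected subgraphs $G_0,\dots,G_{d-1}$ (with no edges of $G$ between different $G_i$), and the children of the root are the roots of separator decompositions of $G_0,\dots,G_{d-1}$. For a node $X$, $\mathcal{T}_X$ denotes the subtree rooted at $X$ and $G_X$ the subgraph of $G$ induced by all vertices contained in nodes of $\mathcal{T}_X$. A nested dissection order $\pi$ induced by $\mathcal{T}$ is obtained by numbering the vertices in the order in which they are visited by a postorder walk of $\mathcal{T}$,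 where the vertices within each node are visited in an arbitrary order; $\pi^{-1}(v)$ is the rank of $v$. Contraction: vertices are processed in increasing rank; to contract a vertex $v$, it is temporarily removed from the current graph and shortcut edges are added between every pair of its remaining (not yet contracted) neighbors. $H$ is the graph consisting of $G$ together with all shortcuts added. The (CCH) search space $S(v)$ of a vertex $v$ is the set of vertices reachable from $v$ in $H$ by paths along which the rank strictly increases (including $v$ itself); equivalently, the set of $v$ and its ancestors in the elimination tree of $H$, in which the parent of $v$ is the lowest-ranked neighbor of $v$ in $H$ with rank higher than $v$. *)

theory Defs
  imports "Graph_Theory.Digraph_Component" "HOL-Library.Multiset"
begin

text \<open>
  The tree node at the root of \<open>Node X ts\<close> is the vertex set \<open>X\<close>. A node of a decomposition is
  identified with the subtree hanging below it.
\<close>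

datatype 'a sep_tree = Node "'a set" "'a sep_tree list"

fun subtrees :: "'a sep_tree \<Rightarrow> 'a sep_tree set" where
  "subtrees (Node X ts) = insert (Node X ts) (\<Union>t\<in>set ts. subtrees t)"

fun tree_verts :: "'a sep_tree \<Rightarrow> 'a set" where
  "tree_verts (Node X ts) = X \<union> (\<Union>t\<in>set ts. tree_verts t)"

definition separates_into ::
    "('a,'b) pre_digraph \<Rightarrow> 'a set \<Rightarrow> ('a,'b) pre_digraph list \<Rightarrow> bool" where
  "separates_into G X Gs \<longleftrightarrow>
     X \<subseteq> verts G \<and>
     (\<Union>H\<in>set Gs. verts H) = verts G - X \<and>
     (\<forall>H\<in>set Gs. induced_subgraph H G \<and> strongly_connected H) \<and>
     (\<forall>i<length Gs. \<forall>j<length Gs. i \<noteq> j \<longrightarrow>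
        verts (Gs ! i) \<inter> verts (Gs ! j) = {} \<and>
        \<not> (\<exists>u\<in>verts (Gs ! i). \<exists>w\<in>verts (Gs ! j). u \<rightarrow>\<^bsub>G\<^esub> w))"

inductive separator_decomposition :: "('a,'b) pre_digraph \<Rightarrow> 'a sep_tree \<Rightarrow> bool" where
  single: "card (verts G) = 1 \<Longrightarrow> separator_decomposition G (Node (verts G) [])"
| separator: "\<lbrakk> card (verts G) > 1; separates_into G X Gs;
     list_all2 separator_decomposition Gs ts \<rbrakk> \<Longrightarrow> separator_decomposition G (Node X ts)"

text \<open>
  An order is the list of the vertices by increasing rank. The tree is unordered in the
  mathematics, so a postorder walk may visit the children in any order \<open>cs\<close>.
\<close>

inductive nested_dissection_order :: "'a sep_tree \<Rightarrow> 'a list \<Rightarrow> bool" where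
  "\<lbrakk> mset cs = mset ts; list_all2 nested_dissection_order cs ps; set xs = X; distinct xs \<rbrakk>
     \<Longrightarrow> nested_dissection_order (Node X ts) (concat ps @ xs)"

definition rank :: "'a list \<Rightarrow> 'a \<Rightarrow> nat" where
  "rank \<pi> = inv_into {..<length \<pi>} (\<lambda>i. \<pi> ! i)"

definition neighbors :: "'a pair_pre_digraph \<Rightarrow> 'a \<Rightarrow> 'a set" where
  "neighbors G v = {u \<in> pverts G. u \<noteq> v \<and> ((u, v) \<in> parcs G \<or> (v, u) \<in> parcs G)}"

definition shortcuts :: "'a pair_pre_digraph \<Rightarrow> 'a \<Rightarrow> 'a rel" where
  "shortcuts G v = {(u, w). u \<in> neighbors G v \<and> w \<in> neighbors G v \<and> u \<noteq> w}"

definition contract :: "'a pair_pre_digraph \<Rightarrow> 'a \<Rightarrow> 'a pair_pre_digraph" where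
  "contract G v = \<lparr> pverts = pverts G - {v},
     parcs = {e \<in> parcs G. fst e \<noteq> v \<and> snd e \<noteq> v} \<union> shortcuts G v \<rparr>"

fun all_shortcuts :: "'a pair_pre_digraph \<Rightarrow> 'a list \<Rightarrow> 'a rel" where
  "all_shortcuts G [] = {}"
| "all_shortcuts G (v # vs) = shortcuts G v \<union> all_shortcuts (contract G v) vs"

definition contraction_hierarchy :: "'a pair_pre_digraph \<Rightarrow> 'a list \<Rightarrow> 'a pair_pre_digraph" where
  "contraction_hierarchy G \<pi> =
     \<lparr> pverts = pverts G, parcs = parcs G \<union> all_shortcuts G \<pi> \<rparr>"

definition upward_graph :: "'a pair_pre_digraph \<Rightarrow> 'a list \<Rightarrow> 'a pair_pre_digraph" where
  "upward_graph H \<pi> =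
     \<lparr> pverts = pverts H, parcs = {(u, w) \<in> parcs H. rank \<pi> u < rank \<pi> w} \<rparr>"

definition search_space :: "'a pair_pre_digraph \<Rightarrow> 'a list \<Rightarrow> 'a \<Rightarrow> 'a set" where
  "search_space H \<pi> v = {w. v \<rightarrow>\<^sup>*\<^bsub>with_proj (upward_graph H \<pi>)\<^esub> w}"

definition boundary :: "('a,'b) pre_digraph \<Rightarrow> ('a,'b) pre_digraph \<Rightarrow> 'a set" where
  "boundary G K = {w \<in> verts G - verts K. \<exists>v\<in>verts K. v \<rightarrow>\<^bsub>G\<^esub> w}"

end

theory Submission
  imports Defs
begin

text \<open>
  A postorder walk lists the vertices of \<open>G\<^sub>X\<close> before all of \<open>B(X)\<close>, because an edge leaving
  \<open>G\<^sub>X\<close> cannot lead to a sibling subtree of a node on the way to the root. As \<open>G\<^sub>X\<close> is connected,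
  any two vertices of \<open>B(X)\<close> are joined by a path whose inner vertices are all contracted
  before its endpoints, so \<open>B(X)\<close> is a clique in \<open>H\<close>. Hence \<open>l\<close> has an upward arc to
  every other vertex of \<open>B(X)\<close>.
\<close>

section \<open>Walks through contracted vertices\<close>

text \<open>A nonempty walk that constrains inner vertices only. Repetitions are allowed, so a
  connection inside a subgraph can be appended without shortening to a simple path.\<close>

inductive path_through :: "'a rel \<Rightarrow> 'a set \<Rightarrow> 'a \<Rightarrow> 'a \<Rightarrow> bool" for E P u where
  arc: "(u, w) \<in> E \<Longrightarrow> path_through E P u w"
| step: "\<lbrakk> path_through E P u c; c \<in> P; (c, w) \<in> E \<rbrakk> \<Longrightarrow> path_through E P u w"

lemma path_through_mono:
  assumes "path_through E P u w" and "P \<subseteq> Q"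
  shows "path_through E Q u w"
  using assms by induction (auto intro: path_through.intros)

text \<open>\<open>reachable\<close> is relative to \<open>verts K\<close>, so every vertex met on
  the way in \<open>K\<close> may serve as an inner vertex.\<close>

lemma path_through_reachable:
  assumes "path_through E (verts K) u v" and "v \<rightarrow>\<^sup>*\<^bsub>K\<^esub> w" and "arcs_ends K \<subseteq> E"
  shows "path_through E (verts K) u w"
  using assms(2,1,3) unfolding reachable_def
  by (induction rule: rtrancl_on_induct) (auto intro: path_through.intros)

lemma pair_wf_digraph_contract:
  "pair_wf_digraph G \<Longrightarrow> pair_wf_digraph (contract G v)"
  by (auto simp: pair_wf_digraph_def contract_def shortcuts_def neighbors_def)

text \<open>
  The second conjunct, on paths that currently end in the contracted vertex \<open>v\<close>, remembers the
  predecessor of \<open>v\<close>, from which a shortcut replaces the detour through \<open>v\<close>.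
\<close>

lemma path_through_contract_aux:
  assumes "pair_wf_digraph G" and "path_through (parcs G) (insert v P) u w" and "u \<noteq> v"
  shows "(w \<noteq> v \<longrightarrow> w = u \<or> path_through (parcs (contract G v)) P u w) \<and>
    (w = v \<longrightarrow> (\<exists>x. (x = u \<or> x \<in> P \<and> path_through (parcs (contract G v)) P u x) \<and>
      x \<noteq> v \<and> (x, v) \<in> parcs G))"
  using assms(2)
proof induction
  case (arc w)
  then show ?case
    using assms(3) by (auto intro!: path_through.arc simp: contract_def)
next
  case (step c w)
  have keep: "(a, b) \<in> parcs (contract G v)" if "(a, b) \<in> parcs G" "a \<noteq> v" "b \<noteq> v" for a b
    using that by (simp add: contract_def)
  show ?case
  proof (cases "c = v")
    case True
    then obtain x where x: "x = u \<or> x \<in> P \<and> path_through (parcs (contract G v)) P u x"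
        "x \<noteq> v" "(x, v) \<in> parcs G"
      using step.IH by blast
    \<comment> \<open>Both \<open>x\<close> and \<open>w\<close> are neighbors of \<open>v\<close>,
      so contraction joins them unless they coincide. The disjunct \<open>w = u\<close> covers walks
      such as \<open>u\<close>, \<open>v\<close>, \<open>u\<close>: no loop is added as a shortcut,
      and the walk restarts at \<open>u\<close>.\<close>
    have "w = u \<or> path_through (parcs (contract G v)) P u w" if "w \<noteq> v"
    proof (cases "x = w")
      case False
      then have "(x, w) \<in> parcs (contract G v)"
        using x step.hyps(3) True that assms(1)
        by (auto simp: contract_def shortcuts_def neighbors_def pair_wf_digraph_def)
      then show ?thesis
        using x(1) by (auto intro: path_through.intros)
    qed (use x(1) in auto)
    then show ?thesis
      using x by auto
  next
    case False
    then have c: "c = u \<or> path_through (parcs (contract G v)) P u c" "c \<in> P"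
      using step by auto
    then show ?thesis
      using False step.hyps(3) keep[of c w] by (auto intro: path_through.intros)
  qed
qed

lemma path_through_contract:
  assumes "pair_wf_digraph G" and "path_through (parcs G) (insert v P) u w"
    and "u \<noteq> v" and "w \<noteq> v" and "u \<noteq> w"
  shows "path_through (parcs (contract G v)) P u w"
  using path_through_contract_aux[OF assms(1-3)] assms(4,5) by auto

text \<open>Each contraction takes one vertex out of the admissible inner vertices, at the cost of
  new arcs that are shortcuts. Once \<open>vs\<close> is used up, no inner vertex is left and the
  walk is a single arc.\<close>

lemma path_through_imp_shortcut:
  assumes "pair_wf_digraph G" and "path_through (parcs G) (set vs) u w"
    and "u \<notin> set vs" and "w \<notin> set vs" and "u \<noteq> w"
  shows "(u, w) \<in> parcs G \<union> all_shortcuts G vs"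
  using assms
proof (induction vs arbitrary: G)
  case Nil
  from Nil.prems(2) show ?case by cases auto
next
  case (Cons v vs)
  have "path_through (parcs (contract G v)) (set vs) u w"
    using Cons.prems by (intro path_through_contract) auto
  then have "(u, w) \<in> parcs (contract G v) \<union> all_shortcuts (contract G v) vs"
    using Cons.prems by (intro Cons.IH pair_wf_digraph_contract) auto
  then show ?case
    by (auto simp: contract_def)
qed

lemma all_shortcuts_append_mono:
  "all_shortcuts G vs \<subseteq> all_shortcuts G (vs @ ws)"
  by (induction vs arbitrary: G) auto

section \<open>Separator decompositions and their postorder walks\<close>

lemma tree_verts_separator_decomposition:
  "separator_decomposition G T \<Longrightarrow> tree_verts T = verts G"
proof (induction rule: separator_decomposition.induct)
  case (separator G X Gs ts)
  have "map tree_verts ts = map verts Gs"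
    using separator.IH by (auto simp: list_all2_conv_all_nth intro!: nth_equalityI)
  then have "tree_verts ` set ts = verts ` set Gs"
    by (metis set_map)
  then show ?case
    using separator.hyps(2) by (auto simp: separates_into_def)
qed simp

lemma set_nested_dissection_order:
  "nested_dissection_order T \<pi> \<Longrightarrow> set \<pi> = tree_verts T"
proof (induction rule: nested_dissection_order.induct)
  case (1 cs ts ps xs X)
  have "map set ps = map tree_verts cs"
    using "1.IH" by (auto simp: list_all2_conv_all_nth intro!: nth_equalityI)
  then have "set ` set ps = tree_verts ` set cs"
    by (metis set_map)
  moreover have "set cs = set ts"
    using "1.hyps"(1) by (metis set_mset_mset)
  ultimately show ?case
    using "1.hyps"(2) by auto
qed

lemma subtree_verts_subset:
  "t \<in> subtrees T \<Longrightarrow> tree_verts t \<subseteq> tree_verts T"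
  by (induction T rule: subtrees.induct) fastforce

text \<open>The descent from the root to \<open>t\<close> passes through separated components, each
  strongly connected by \<open>separates_into\<close>; the component reached at \<open>t\<close> is
  \<open>K\<close>.\<close>

lemma subtree_connected:
  assumes "separator_decomposition G T" and "t \<in> subtrees T"
    and "wf_digraph G" and "strongly_connected G"
  shows "\<exists>K. subgraph K G \<and> strongly_connected K \<and> verts K = tree_verts t"
  using assms
proof (induction arbitrary: t rule: separator_decomposition.induct)
  case (single G)
  then show ?case
    using wf_digraph.subgraph_refl by (intro exI[of _ G]) auto
next
  case (separator G X Gs ts)
  have "separator_decomposition G (Node X ts)"
    using separator.hyps separator.IH
    by (auto intro!: separator_decomposition.separator elim: list_all2_mono)
  note verts_T = tree_verts_separator_decomposition[OF this]
  show ?case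
  proof (cases "t = Node X ts")
    case True
    then show ?thesis
      using separator.prems verts_T wf_digraph.subgraph_refl by (intro exI[of _ G]) auto
  next
    case False
    then obtain i where i: "i < length ts" "t \<in> subtrees (ts ! i)"
      using separator.prems(1) by (auto simp: in_set_conv_nth)
    have "Gs ! i \<in> set Gs"
      using i separator.IH by (simp add: list_all2_lengthD)
    then have Gi: "subgraph (Gs ! i) G" "strongly_connected (Gs ! i)"
      using separator.hyps(2) by (auto simp: separates_into_def induced_subgraph_def)
    then have "\<exists>K. subgraph K (Gs ! i) \<and> strongly_connected K \<and> verts K = tree_verts t"
      using separator.IH i by (auto simp: list_all2_conv_all_nth subgraph_def)
    then show ?thesis
      using Gi(1) subgraph_trans by blast
  qed
qed

text \<open>The prefix \<open>p\<close> ends with the walk of \<open>t\<close>. Apart from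
  \<open>t\<close> it holds only sibling subtrees of \<open>t\<close> or of its ancestors, and
  separators leave no arcs into these. A prefix is used instead of ranks because
  \<open>all_shortcuts\<close> consumes a list.\<close>

lemma nested_dissection_order_prefix:
  assumes "separator_decomposition G T" and "nested_dissection_order T \<pi>" and "t \<in> subtrees T"
  shows "\<exists>p q. \<pi> = p @ q \<and> tree_verts t \<subseteq> set p \<and>
    (\<forall>u\<in>tree_verts t. \<forall>w\<in>verts G - tree_verts t. u \<rightarrow>\<^bsub>G\<^esub> w \<longrightarrow> w \<notin> set p)"
  using assms
proof (induction arbitrary: t \<pi> rule: separator_decomposition.induct)
  case (single G)
  then show ?case
    using set_nested_dissection_order[OF single.prems(1)]
    by (intro exI[of _ \<pi>] exI[of _ "[]"]) auto
next
  case (separator G X Gs ts)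
  have "separator_decomposition G (Node X ts)"
    using separator.hyps separator.IH
    by (auto intro!: separator_decomposition.separator elim: list_all2_mono)
  note verts_T = tree_verts_separator_decomposition[OF this]
  show ?case
  proof (cases "t = Node X ts")
    case True
    then show ?thesis
      using set_nested_dissection_order[OF separator.prems(1)] verts_T
      by (intro exI[of _ \<pi>] exI[of _ "[]"]) auto
  next
    case False
    have len: "length Gs = length ts"
      using separator.IH by (simp add: list_all2_lengthD)
    have verts_ts: "tree_verts (ts ! i) = verts (Gs ! i)" if "i < length ts" for i
      using separator.IH that
      by (auto simp: list_all2_conv_all_nth intro!: tree_verts_separator_decomposition)
    have ts_nonempty: "verts (Gs ! i) \<noteq> {}" if "i < length ts" for i
    proof -
      have "Gs ! i \<in> set Gs" using that len by simp
      then show ?thesis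
        using separator.hyps(2) unfolding separates_into_def strongly_connected_def by blast
    qed
    have apart: "verts (Gs ! i) \<inter> verts (Gs ! j) = {}"
      "u \<in> verts (Gs ! i) \<Longrightarrow> w \<in> verts (Gs ! j) \<Longrightarrow> \<not> u \<rightarrow>\<^bsub>G\<^esub> w"
      if "i < length ts" "j < length ts" "i \<noteq> j" for i j u w
      using separator.hyps(2) that len unfolding separates_into_def by auto
    \<comment> \<open>Equal children would share a nonempty vertex set. Distinctness is what later
      tells the child walked at \<open>m < j\<close> apart from the one walked at \<open>j\<close>,
      since a reordering preserves only values.\<close>
    have "distinct ts"
      unfolding distinct_conv_nth
      using apart(1) ts_nonempty verts_ts by (metis inf.idem)
    obtain cs ps xs where \<pi>: "\<pi> = concat ps @ xs" "mset cs = mset ts"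
        "list_all2 nested_dissection_order cs ps"
      using separator.prems(1) by (cases rule: nested_dissection_order.cases) auto
    have cs: "set cs = set ts" "distinct cs"
      using \<pi>(2) \<open>distinct ts\<close> by (metis set_mset_mset, metis mset_eq_imp_distinct_iff)
    have lenc: "length ps = length cs"
      using \<pi>(3) by (simp add: list_all2_lengthD)
    obtain j where j: "j < length cs" "t \<in> subtrees (cs ! j)"
      using separator.prems(2) False cs(1) by (auto simp: in_set_conv_nth) (metis in_set_conv_nth)
    obtain i where i: "i < length ts" "ts ! i = cs ! j"
      using j(1) cs(1) by (metis in_set_conv_nth nth_mem)
    have set_ps: "set (ps ! k) = tree_verts (cs ! k)" if "k < length cs" for k
      using \<pi>(3) that by (intro set_nested_dissection_order) (simp add: list_all2_nthD)
    have "nested_dissection_order (ts ! i) (ps ! j)"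
      using \<pi>(3) j i by (auto simp: list_all2_conv_all_nth)
    then have "\<exists>p q. ps ! j = p @ q \<and> tree_verts t \<subseteq> set p \<and>
        (\<forall>u\<in>tree_verts t. \<forall>w\<in>verts (Gs ! i) - tree_verts t. u \<rightarrow>\<^bsub>Gs ! i\<^esub> w \<longrightarrow> w \<notin> set p)"
      using separator.IH i j by (auto simp: list_all2_conv_all_nth)
    then obtain p q where pq: "ps ! j = p @ q" "tree_verts t \<subseteq> set p"
        "\<And>u w. u \<in> tree_verts t \<Longrightarrow> w \<in> verts (Gs ! i) - tree_verts t \<Longrightarrow> u \<rightarrow>\<^bsub>Gs ! i\<^esub> w \<Longrightarrow> w \<notin> set p"
      by blast
    \<comment> \<open>All children walked before the one containing \<open>t\<close>, then the
      prefix found inside that child's own walk.\<close>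
    let ?p = "concat (take j ps) @ p"
    have \<pi>_split: "\<pi> = ?p @ (q @ concat (drop (Suc j) ps) @ xs)"
      using \<pi>(1) pq(1) j(1) lenc id_take_nth_drop[of j ps]
      by (metis append.assoc concat.simps(2) concat_append)
    have earlier: "\<exists>k<length ts. k \<noteq> i \<and> w \<in> verts (Gs ! k)" if "w \<in> set (concat (take j ps))" for w
    proof -
      obtain m where m: "m < j" "m < length cs" "w \<in> set (ps ! m)"
        using \<open>w \<in> _\<close> j(1) lenc by (auto simp: nth_image[symmetric])
      obtain k where k: "k < length ts" "ts ! k = cs ! m"
        using m(2) cs(1) by (metis in_set_conv_nth nth_mem)
      have "k \<noteq> i"
        using k i m j cs(2) by (auto simp: nth_eq_iff_index_eq)
      then show ?thesis
        using k m set_ps verts_ts by metis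
    qed
    have t_verts: "tree_verts t \<subseteq> verts (Gs ! i)"
      using subtree_verts_subset[OF j(2)] i verts_ts by metis
    have "w \<notin> set ?p" if uw: "u \<in> tree_verts t" "w \<in> verts G - tree_verts t" "u \<rightarrow>\<^bsub>G\<^esub> w" for u w
    proof
      assume "w \<in> set ?p"
      then consider "w \<in> set (concat (take j ps))" | "w \<in> set p" by auto
      then show False
      proof cases
        case 1
        then show False
          using earlier apart(2) i(1) uw t_verts by blast
      next
        case 2
        \<comment> \<open>Here \<open>w\<close> lies in the same component as \<open>t\<close>.
          Components are induced, so the arc of \<open>G\<close> survives in \<open>Gs ! i\<close>
          and the induction hypothesis applies.\<close>
        then have w: "w \<in> verts (Gs ! i)"
          using pq(1) set_ps[OF j(1)] i verts_ts[OF i(1)] by auto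
        have "Gs ! i \<in> set Gs"
          using i(1) len by simp
        then have "induced_subgraph (Gs ! i) G"
          using separator.hyps(2) by (simp add: separates_into_def)
        then have "u \<rightarrow>\<^bsub>Gs ! i\<^esub> w"
          using uw w t_verts
          by (auto simp: induced_subgraph_def subgraph_def compatible_def arcs_ends_conv)
        then show False
          using pq(3) uw w 2 by blast
      qed
    qed
    then show ?thesis
      using \<pi>_split pq(2) by (intro exI[of _ ?p] exI conjI) auto
  qed
qed

section \<open>Boundary cliques and search spaces\<close>

lemma boundary_clique:
  assumes "pair_pseudo_graph G" and "strongly_connected (with_proj G)"
    and "separator_decomposition (with_proj G) T" and "nested_dissection_order T \<pi>"
    and "t \<in> subtrees T"
    and "a \<in> boundary (with_proj G) (with_proj G \<restriction> tree_verts t)"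
    and "b \<in> boundary (with_proj G) (with_proj G \<restriction> tree_verts t)" and "a \<noteq> b"
  shows "(a, b) \<in> parcs (contraction_hierarchy G \<pi>)"
proof -
  interpret pair_pseudo_graph G by fact
  obtain K where K: "subgraph K (with_proj G)" "strongly_connected K" "verts K = tree_verts t"
    using subtree_connected[OF assms(3,5) _ assms(2)] wf_digraph_axioms by blast
  obtain p q where pq: "\<pi> = p @ q" "tree_verts t \<subseteq> set p"
      "\<And>u w. u \<in> tree_verts t \<Longrightarrow> w \<in> pverts G - tree_verts t \<Longrightarrow> (u, w) \<in> parcs G \<Longrightarrow> w \<notin> set p"
    using nested_dissection_order_prefix[OF assms(3-5)] by auto
  obtain c d where c: "c \<in> tree_verts t" "(c, a) \<in> parcs G" "a \<in> pverts G - tree_verts t"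
      and d: "d \<in> tree_verts t" "(d, b) \<in> parcs G" "b \<in> pverts G - tree_verts t"
    using assms(6,7) by (auto simp: boundary_def)
  \<comment> \<open>Bidirectedness reverses the arc into \<open>a\<close>, so the walk can start at
    \<open>a\<close>, cross \<open>K\<close> from \<open>c\<close> to \<open>d\<close> and leave to
    \<open>b\<close>.\<close>
  have "(a, c) \<in> parcs G"
    using c(2) arcs_ends_symmetric[of "with_proj G"] pair_sym_arcs by simp
  moreover have "c \<rightarrow>\<^sup>*\<^bsub>K\<^esub> d"
    using K(2,3) c(1) d(1) by (simp add: strongly_connected_def)
  moreover have "arcs_ends K \<subseteq> parcs G"
    using arcs_ends_mono[OF K(1)] by simp
  ultimately have "path_through (parcs G) (verts K) a d"
    using path_through_reachable path_through.arc by metis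
  then have "path_through (parcs G) (verts K) a b"
    using d K(3) by (auto intro: path_through.step)
  then have "path_through (parcs G) (set p) a b"
    using path_through_mono pq(2) K(3) by metis
  \<comment> \<open>Contracting \<open>p\<close> alone joins \<open>a\<close> and \<open>b\<close>:
    it contains all inner vertices but neither endpoint.\<close>
  then have "(a, b) \<in> parcs G \<union> all_shortcuts G p"
    using c d pq(3) assms(8) by (intro path_through_imp_shortcut pair_wf_digraph_axioms) blast+
  then show ?thesis
    using pq(1) all_shortcuts_append_mono[of G p q] by (auto simp: contraction_hierarchy_def)
qed

text \<open>A chosen inverse is injective on the image of any list, repetitions or not. This makes
  the minimal rank of \<open>l\<close> strict.\<close>

lemma inj_on_rank: "inj_on (rank \<pi>) (set \<pi>)"
proof -
  have "set \<pi> = (\<lambda>i. \<pi> ! i) ` {..<length \<pi>}"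
    by (auto simp: set_conv_nth)
  then show ?thesis
    unfolding rank_def by (metis inj_on_inv_into subset_refl)
qed

theorem theorem3:
  fixes G H :: "'a pair_pre_digraph" and T :: "'a sep_tree" and \<pi> :: "'a list"
    and X B :: "'a set" and ts :: "'a sep_tree list" and l :: 'a
  assumes "pair_pseudo_graph G" and "strongly_connected (with_proj G)"
    and "separator_decomposition (with_proj G) T"
    and "nested_dissection_order T \<pi>"
    and "H = contraction_hierarchy G \<pi>"
    and "Node X ts \<in> subtrees T"
    and "B = boundary (with_proj G) (with_proj G \<restriction> tree_verts (Node X ts))"
    and "B \<noteq> {}"
    and "is_arg_min (rank \<pi>) (\<lambda>b. b \<in> B) l"
  shows "search_space H \<pi> l = (\<Union>b\<in>B. search_space H \<pi> b)"
proof -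
  have l: "l \<in> B" "\<And>b. b \<in> B \<Longrightarrow> rank \<pi> l \<le> rank \<pi> b"
    using assms(9) by (auto simp: is_arg_min_linorder)
  have B_verts: "B \<subseteq> pverts G"
    using assms(7) by (auto simp: boundary_def)
  then have B_ranked: "B \<subseteq> set \<pi>"
    using set_nested_dissection_order[OF assms(4)] tree_verts_separator_decomposition[OF assms(3)]
    by simp
  have "search_space H \<pi> b \<subseteq> search_space H \<pi> l" if b: "b \<in> B" for b
  proof (cases "b = l")
    case False
    then have "rank \<pi> l < rank \<pi> b"
      using l b B_ranked inj_on_rank by (metis inj_onD le_neq_implies_less subsetD)
    moreover have "(l, b) \<in> parcs H"
      using boundary_clique[OF assms(1-4,6)] assms(5,7) l(1) b False by simp
    ultimately have "(l, b) \<in> parcs (upward_graph H \<pi>)"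
      by (simp add: upward_graph_def)
    \<comment> \<open>\<open>reachable\<close> demands that the start be a vertex; then the arc from
      \<open>l\<close> to \<open>b\<close> can be prepended to every upward path from
      \<open>b\<close>.\<close>
    moreover have "l \<in> pverts (upward_graph H \<pi>)"
      using l(1) B_verts assms(5) by (auto simp: upward_graph_def contraction_hierarchy_def)
    ultimately show ?thesis
      by (auto simp: search_space_def reachable_def intro: converse_rtrancl_on_into_rtrancl_on)
  qed simp
  then show ?thesis
    using l(1) by blast
qed

end
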